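(* Let $(\mathfrak a,\omega)$ be two-step shear data on $\mathbb R^{2n}$, equipped with a flat Kähler structure $(g,J)$, such that the shear is SKT. Then there are a unitary basis $(Y_1,\dots,Y_m)$ of $\mathfrak a_J$ and $\alpha_1,\dots,\alpha_m\in\mathfrak a_r^*\otimes\mathbb C$ such that $$K_X(Y_i)=\alpha_i(X)\cdot Y_i$$ for all $X\in\mathfrak a_r$ and all $i=1,\dots,m$.
   Context: $\mathbb R^{2n}$ is regarded as an Abelian Lie algebra with an inner product $g$ and an endomorphism $J$, $J^2=-\mathrm{id}$, $g(J\cdot,J\cdot)=g$. Two-step shear data $(\mathfrak a,\omega)$ on $\mathbb R^{2n}$ consists of a linear subspace $\mathfrak a\subseteq\mathbb R^{2n}$ and a two-form $\omega\in\Lambda^2(\mathbb R^{2n})^*\otimes\mathfrak a$ with values in $\mathfrak a$ such that $\omega|_{\Lambda^2\mathfrak a}=0$ and $\omega(\omega(X,Y),Z)+\omega(\omega(Y,Z),X)+\omega(\omega(Z,X),Y)=0$ for all $X,Y,Z$. The shear is the Lie algebra with underlying vector space $\mathbb R^{2n}$ and bracket $[X,Y]=\omega(X,Y)$, equipped with the same $g$ and $J$. It is SKT if $J$ is integrable ($[JX,JY]-J[JX,Y]-J[X,JY]-[X,Y]=0$) and $d(J^*d\sigma)=0$ with $\sigma=g(J\cdot,\cdot)$, $d$ the Chevalley–Eilenberg differential and $(J^*\beta)(X_1,\dots,X_k)=\beta(JX_1,\dots,JX_k)$. Put $\mathfrak a_J=\mathfrak a\cap J\mathfrak a$ and let $\mathfrak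 a_r$ be the orthogonal complement of $\mathfrak a_J$ in $\mathfrak a$. $\mathfrak a_J$ is regarded as a complex vector space via $(s+it)Y=sY+tJY$, with the Hermitian inner product whose real part is $g$; $m=\dim_{\mathbb C}\mathfrak a_J$. For $X\in\mathfrak a_r$, $K_X\in\operatorname{End}(\mathfrak a_J)$ is the $\operatorname{End}(\mathfrak a_J)$-component of $A_X:=-\omega(JX,\cdot)|_{\mathfrak a}\in\operatorname{End}(\mathfrak a)$ with respect to the splitting $\mathfrak a=\mathfrak a_J\oplus\mathfrak a_r$, i.e. $K_X(Y)$ is the $\mathfrak a_J$-component of $-\omega(JX,Y)$ for $Y\in\mathfrak a_J$. *)

theory Defs
  imports "HOL-Analysis.Analysis"
begin

text \<open>The parallel tensors on the Abelian Lie algebra \<open>\<real>\<^sup>2\<^sup>n\<close>: an arbitrary inner product \<open>g\<close>, not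
  necessarily the one of the type class, and a \<open>g\<close>-orthogonal complex structure \<open>J\<close>.\<close>

definition flat_kaehler :: "('a::real_vector \<Rightarrow> 'a \<Rightarrow> real) \<Rightarrow> ('a \<Rightarrow> 'a) \<Rightarrow> bool" where
  "flat_kaehler g J \<longleftrightarrow>
     bilinear g \<and> (\<forall>X Y. g X Y = g Y X) \<and> (\<forall>X. X \<noteq> 0 \<longrightarrow> g X X > 0) \<and>
     linear J \<and> (\<forall>X. J (J X) = - X) \<and> (\<forall>X Y. g (J X) (J Y) = g X Y)"

definition two_step_shear_data :: "'a::real_vector set \<Rightarrow> ('a \<Rightarrow> 'a \<Rightarrow> 'a) \<Rightarrow> bool" where
  "two_step_shear_data \<aa> \<omega> \<longleftrightarrow>
     subspace \<aa> \<and>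
     bilinear \<omega> \<and> (\<forall>X. \<omega> X X = 0) \<and> (\<forall>X Y. \<omega> X Y \<in> \<aa>) \<and>
     (\<forall>X\<in>\<aa>. \<forall>Y\<in>\<aa>. \<omega> X Y = 0) \<and>
     (\<forall>X Y Z. \<omega> (\<omega> X Y) Z + \<omega> (\<omega> Y Z) X + \<omega> (\<omega> Z X) Y = 0)"

text \<open>A \<open>k\<close>-form is represented by its values on argument lists of length \<open>k\<close>. The
  Chevalley--Eilenberg differential (trivial coefficients) of a \<open>k\<close>-form \<open>\<beta>\<close> is
  \<open>(d\<beta>)(X\<^sub>0,\<dots>,X\<^sub>k) = (\<Sum>i<j. (-1)\<^sup>i\<^sup>+\<^sup>j \<beta>([X\<^sub>i,X\<^sub>j],X\<^sub>0,\<dots>,X\<^sub>k))\<close>, where \<open>X\<^sub>i\<close> and \<open>X\<^sub>j\<close> are omitted from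
  the arguments after the bracket.\<close>

definition ce_diff :: "('a \<Rightarrow> 'a \<Rightarrow> 'a) \<Rightarrow> ('a list \<Rightarrow> real) \<Rightarrow> 'a list \<Rightarrow> real" where
  "ce_diff br \<beta> Xs =
     (\<Sum>j<length Xs. \<Sum>i<j.
        (- 1) ^ (i + j) * \<beta> (br (Xs ! i) (Xs ! j) # nths Xs (- {i, j})))"

definition J_pullback :: "('a \<Rightarrow> 'a) \<Rightarrow> ('a list \<Rightarrow> real) \<Rightarrow> 'a list \<Rightarrow> real" where
  "J_pullback J \<beta> Xs = \<beta> (map J Xs)"

definition kaehler_form :: "('a \<Rightarrow> 'a \<Rightarrow> real) \<Rightarrow> ('a \<Rightarrow> 'a) \<Rightarrow> 'a list \<Rightarrow> real" where
  "kaehler_form g J Xs = g (J (Xs ! 0)) (Xs ! 1)"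

definition integrable_on_lie :: "('a::real_vector \<Rightarrow> 'a \<Rightarrow> 'a) \<Rightarrow> ('a \<Rightarrow> 'a) \<Rightarrow> bool" where
  "integrable_on_lie br J \<longleftrightarrow>
     (\<forall>X Y. br (J X) (J Y) - J (br (J X) Y) - J (br X (J Y)) - br X Y = 0)"

definition SKT ::
  "('a::real_vector \<Rightarrow> 'a \<Rightarrow> 'a) \<Rightarrow> ('a \<Rightarrow> 'a \<Rightarrow> real) \<Rightarrow> ('a \<Rightarrow> 'a) \<Rightarrow> bool" where
  "SKT br g J \<longleftrightarrow>
     integrable_on_lie br J \<and>
     (\<forall>Xs. length Xs = 4 \<longrightarrow>
        ce_diff br (J_pullback J (ce_diff br (kaehler_form g J))) Xs = 0)"

definition a_J :: "('a \<Rightarrow> 'a) \<Rightarrow> 'a set \<Rightarrow> 'a set" where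
  "a_J J \<aa> = \<aa> \<inter> J ` \<aa>"

definition a_r :: "('a \<Rightarrow> 'a \<Rightarrow> real) \<Rightarrow> ('a \<Rightarrow> 'a) \<Rightarrow> 'a set \<Rightarrow> 'a set" where
  "a_r g J \<aa> = {X \<in> \<aa>. \<forall>Y \<in> a_J J \<aa>. g X Y = 0}"

definition a_J_part ::
  "('a::real_vector \<Rightarrow> 'a \<Rightarrow> real) \<Rightarrow> ('a \<Rightarrow> 'a) \<Rightarrow> 'a set \<Rightarrow> 'a \<Rightarrow> 'a" where
  "a_J_part g J \<aa> V = (THE U. U \<in> a_J J \<aa> \<and> V - U \<in> a_r g J \<aa>)"

definition K ::
  "('a::real_vector \<Rightarrow> 'a \<Rightarrow> real) \<Rightarrow> ('a \<Rightarrow> 'a) \<Rightarrow> 'a set \<Rightarrow> ('a \<Rightarrow> 'a \<Rightarrow> 'a) \<Rightarrow> 'a \<Rightarrow> 'a \<Rightarrow> 'a" where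
  "K g J \<aa> \<omega> X Y = a_J_part g J \<aa> (- \<omega> (J X) Y)"

text \<open>When \<open>J\<close> is a linear map with square \<open>-id\<close>, this scalar multiplication makes the whole type a
  complex vector space, so that the notions of the library locale \<open>vector_space\<close> apply to it.\<close>

definition J_scale :: "('a::real_vector \<Rightarrow> 'a) \<Rightarrow> complex \<Rightarrow> 'a \<Rightarrow> 'a" where
  "J_scale J z Y = Re z *\<^sub>R Y + Im z *\<^sub>R J Y"

text \<open>The Hermitian inner product with real part \<open>g\<close>, complex-linear in the first argument.\<close>

definition herm :: "('a \<Rightarrow> 'a \<Rightarrow> real) \<Rightarrow> ('a \<Rightarrow> 'a) \<Rightarrow> 'a \<Rightarrow> 'a \<Rightarrow> complex" where
  "herm g J Y Z = Complex (g Y Z) (g Y (J Z))"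

definition unitary_basis ::
  "('a::real_vector \<Rightarrow> 'a \<Rightarrow> real) \<Rightarrow> ('a \<Rightarrow> 'a) \<Rightarrow> nat \<Rightarrow> (nat \<Rightarrow> 'a) \<Rightarrow> 'a set \<Rightarrow> bool" where
  "unitary_basis g J m Y V \<longleftrightarrow>
     inj_on Y {1..m} \<and> \<not> module.dependent (J_scale J) (Y ` {1..m}) \<and>
     module.span (J_scale J) (Y ` {1..m}) = V \<and>
     (\<forall>i\<in>{1..m}. \<forall>j\<in>{1..m}. herm g J (Y i) (Y j) = (if i = j then 1 else 0))"

text \<open>Elements of \<open>V\<^sup>* \<otimes> \<complex>\<close> are the real linear maps from the subspace \<open>V\<close> to \<open>\<complex>\<close>; values outside
  \<open>V\<close> are irrelevant.\<close>

definition complex_form_on :: "'a::real_vector set \<Rightarrow> ('a \<Rightarrow> complex) \<Rightarrow> bool" where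
  "complex_form_on V \<alpha> \<longleftrightarrow>
     (\<forall>X\<in>V. \<forall>Y\<in>V. \<alpha> (X + Y) = \<alpha> X + \<alpha> Y) \<and>
     (\<forall>X\<in>V. \<forall>c. \<alpha> (c *\<^sub>R X) = c *\<^sub>R \<alpha> X)"

end

theory Submission
  imports Defs "HOL-Computational_Algebra.Fundamental_Theorem_Algebra"
begin

text \<open>The maps \<open>A\<^sub>X = - \<omega>(J X, \<cdot>)\<close> with \<open>X \<in> \<aa>\<close> preserve \<open>\<aa>\<^sub>J\<close>, are complex linear there because \<open>J\<close> is
  integrable, and commute by the Jacobi identity. The SKT equation on \<open>(J X, X, Y, J Z)\<close> becomes
  \<open>h(A\<^sub>X\<^sup>2 Y, Z) + h(Y, A\<^sub>X\<^sup>2 Z) + 2 h(A\<^sub>X Y, A\<^sub>X Z) = h(A\<^sub>W Y, Z) + h(Y, A\<^sub>W Z)\<close> with \<open>W = \<omega>(J X, X)\<close>.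
  Take a maximal orthonormal set \<open>B\<close> of joint eigenvectors. If it does not span, the compressions
  of the \<open>A\<^sub>X\<close> to its orthogonal complement have a joint unit eigenvector \<open>v\<close>, so that
  \<open>A\<^sub>X v = \<alpha>\<^sub>X v + u\<^sub>X\<close> with \<open>u\<^sub>X\<close> in the span of \<open>B\<close>. If \<open>u\<^sub>X\<close> had a nonzero \<open>b\<close>-component, where \<open>b \<in> B\<close>
  has eigenvalue \<open>\<beta>\<^sub>X\<close>, commutativity and the SKT identity on \<open>(v,v)\<close>, \<open>(v,b)\<close>, \<open>(b,b)\<close> would give
  \<open>|u\<^sub>X|\<^sup>2 = - |\<alpha>\<^sub>X - \<beta>\<^sub>X|\<^sup>2\<close>. Hence \<open>v\<close> is itself a joint eigenvector, against maximality.\<close>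

text \<open>\<open>\<alpha>\<close>, \<open>\<beta>\<close>, \<open>u\<close> are the diagonal and off-diagonal entries of \<open>A\<^sub>X\<close> at \<open>v\<close> and \<open>b\<close>; the primed ones are
  those of \<open>A\<^sub>W\<close>, and \<open>r = |u\<^sub>X|\<^sup>2\<close>.\<close>

lemma off_diagonal_entry_zero:
  fixes \<alpha> \<beta> u \<alpha>' \<beta>' u' :: complex and r :: real
  assumes comm: "(\<alpha>' - \<beta>') * u = (\<alpha> - \<beta>) * u'"
    and vv: "\<alpha>\<^sup>2 + cnj (\<alpha>\<^sup>2) + 2 * (\<alpha> * cnj \<alpha> + of_real r) = \<alpha>' + cnj \<alpha>'"
    and vb: "\<alpha> * u + u * \<beta> + 2 * (cnj \<beta> * u) = u'"
    and bb: "\<beta>\<^sup>2 + cnj (\<beta>\<^sup>2) + 2 * (\<beta> * cnj \<beta>) = \<beta>' + cnj \<beta>'"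
    and r: "r > 0"
  shows "u = 0"
proof (rule ccontr)
  assume "u \<noteq> 0"
  have "(\<alpha>' - \<beta>') * u = ((\<alpha> - \<beta>) * (\<alpha> + \<beta> + 2 * cnj \<beta>)) * u"
    unfolding comm vb[symmetric] by (simp add: algebra_simps)
  with \<open>u \<noteq> 0\<close> have "Re (\<alpha>' - \<beta>') = Re ((\<alpha> - \<beta>) * (\<alpha> + \<beta> + 2 * cnj \<beta>))"
    by simp
  moreover have "Re (\<alpha>\<^sup>2 + cnj (\<alpha>\<^sup>2) + 2 * (\<alpha> * cnj \<alpha> + of_real r)) = Re (\<alpha>' + cnj \<alpha>')"
    and "Re (\<beta>\<^sup>2 + cnj (\<beta>\<^sup>2) + 2 * (\<beta> * cnj \<beta>)) = Re (\<beta>' + cnj \<beta>')"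
    using vv bb by simp_all
  \<comment> \<open>The two equations of real parts say
    \<open>Re \<alpha>' = 2 * (Re \<alpha>)^2 + r\<close> and
    \<open>Re \<beta>' = 2 * (Re \<beta>)^2\<close>; inserting them into the first equation and
    completing squares isolates \<open>r\<close>.\<close>
  ultimately have "r = - (Re \<alpha> - Re \<beta>)\<^sup>2 - (Im \<alpha> - Im \<beta>)\<^sup>2"
    by (simp add: power2_eq_square algebra_simps)
  with r show False
    using zero_le_power2[of "Re \<alpha> - Re \<beta>"] zero_le_power2[of "Im \<alpha> - Im \<beta>"] by linarith
qed

section \<open>Complex and Hermitian structure defined by g and J\<close>

locale hermitian_space =
  fixes g :: "'a::euclidean_space \<Rightarrow> 'a \<Rightarrow> real" and J :: "'a \<Rightarrow> 'a"
  assumes kaehler: "flat_kaehler g J"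
begin

lemma bilinear_g: "bilinear g"
  and g_commute: "g x y = g y x"
  and g_pos: "x \<noteq> 0 \<Longrightarrow> g x x > 0"
  and linear_J: "linear J"
  and J_J [simp]: "J (J x) = - x"
  and g_J_J [simp]: "g (J x) (J y) = g x y"
  using kaehler unfolding flat_kaehler_def by blast+

lemmas g_simps = bilinear_ladd[OF bilinear_g] bilinear_radd[OF bilinear_g]
  bilinear_lmul[OF bilinear_g] bilinear_rmul[OF bilinear_g]
  bilinear_lneg[OF bilinear_g] bilinear_rneg[OF bilinear_g]
  bilinear_lzero[OF bilinear_g] bilinear_rzero[OF bilinear_g]
  bilinear_lsub[OF bilinear_g] bilinear_rsub[OF bilinear_g]

lemmas J_simps = linear_add[OF linear_J] linear_scale[OF linear_J] linear_neg[OF linear_J]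
  linear_diff[OF linear_J] linear_0[OF linear_J]

lemma g_J_left: "g (J x) y = - g x (J y)"
proof -
  have "g (J x) y = g (J (J x)) (J y)" by (simp only: g_J_J)
  then show ?thesis by (simp add: g_simps)
qed

sublocale C: vector_space "J_scale J"
  by unfold_locales (auto simp: J_scale_def J_simps algebra_simps scaleR_add_left)

abbreviation h :: "'a \<Rightarrow> 'a \<Rightarrow> complex" where "h \<equiv> herm g J"

lemma h_add_left: "h (x + y) z = h x z + h y z"
  and h_add_right: "h x (y + z) = h x y + h x z"
  and h_diff_left: "h (x - y) z = h x z - h y z"
  and h_zero_left: "h 0 z = 0"
  and h_scale_left: "h (J_scale J c x) z = c * h x z"
  and h_scale_right: "h x (J_scale J c z) = cnj c * h x z"
  and h_self: "h x x = of_real (g x x)"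
  and h_commute: "h y x = cnj (h x y)"
  and h_scaleR_left: "h (r *\<^sub>R x) z = of_real r * h x z"
proof -
  have "g x (J x) = 0" for x
    using g_J_left[of x x] g_commute[of x "J x"] by simp
  then show "h x x = of_real (g x x)"
    by (simp add: herm_def complex_eq_iff)
  show "h y x = cnj (h x y)"
    using g_J_left[of x y] by (simp add: herm_def complex_eq_iff g_commute)
qed (auto simp: herm_def complex_eq_iff J_scale_def J_simps g_simps g_J_left)

lemmas h_simps = h_add_left h_add_right h_diff_left h_zero_left
  h_scale_left h_scale_right

lemma h_sum_left: "h (sum f A) z = (\<Sum>a\<in>A. h (f a) z)"
  by (induction A rule: infinite_finite_induct) (simp_all add: h_simps)

lemma scaleR_eq_J_scale: "r *\<^sub>R x = J_scale J (of_real r) x"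
  by (simp add: J_scale_def)

lemma C_subspace_imp_subspace:
  assumes "C.subspace W" shows "subspace W"
  using assms unfolding C.subspace_def subspace_def by (simp add: scaleR_eq_J_scale)

section \<open>Eigenvectors and joint eigenvectors on complex subspaces\<close>

text \<open>Induction on the degree: a root z splits p as (X - z) q, and w = q(f) v satisfies f w =
  z w. Either w is nonzero and is the eigenvector, or q annihilates v in lower degree. Degree 0 is
  impossible since v is nonzero. Linearity of f is asked on W alone, so that restrictions and
  compressions fit.\<close>

lemma eigenvector_of_annihilating_poly:
  fixes p :: "complex poly"
  assumes W: "C.subspace W"
    and inv: "\<And>x. x \<in> W \<Longrightarrow> f x \<in> W"
    and add: "\<And>x y. x \<in> W \<Longrightarrow> y \<in> W \<Longrightarrow> f (x + y) = f x + f y"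
    and scale: "\<And>c x. x \<in> W \<Longrightarrow> f (J_scale J c x) = J_scale J c (f x)"
    and v: "v \<in> W" "v \<noteq> 0"
    and "p \<noteq> 0" and "(\<Sum>i\<le>degree p. J_scale J (coeff p i) ((f ^^ i) v)) = 0"
  shows "\<exists>z. \<exists>x\<in>W. x \<noteq> 0 \<and> f x = J_scale J z x"
  using assms(7,8)
proof (induction "degree p" arbitrary: p)
  case 0
  then have "J_scale J (coeff p 0) v = 0" "coeff p 0 \<noteq> 0"
    by (auto simp: leading_coeff_0_iff[of p, symmetric] simp del: leading_coeff_0_iff)
  then show ?case using v by simp
next
  case (Suc n)
  have fv: "(f ^^ i) v \<in> W" for i
    by (induction i) (auto intro: v inv)
  have f0: "f 0 = 0"
    using scale[of v 0] v by simp
  have f_sum: "f (\<Sum>i\<in>I. J_scale J (c i) ((f ^^ i) v)) = (\<Sum>i\<in>I. J_scale J (c i) ((f ^^ Suc i) v))"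
    if "finite I" for I c
    using that
  proof induction
    case (insert i I)
    have "(\<Sum>i\<in>I. J_scale J (c i) ((f ^^ i) v)) \<in> W"
      by (intro C.subspace_sum[OF W] C.subspace_scale[OF W] fv)
    with insert show ?case
      by (simp add: add scale C.subspace_scale[OF W] fv)
  qed (simp add: f0)
  have "\<not> constant (poly p)"
    using Suc.hyps(2) by (simp add: constant_degree)
  then obtain z where "poly p z = 0"
    using fundamental_theorem_of_algebra by blast
  then obtain q where p: "p = [:-z, 1:] * q"
    by (auto simp: poly_eq_0_iff_dvd elim: dvdE)
  with Suc.prems have "q \<noteq> 0" by auto
  then have "degree p = Suc (degree q)"
    using p by (simp add: degree_mult_eq del: mult_pCons_left)
  with Suc.hyps have n: "degree q = n" by simp
  define w where "w = (\<Sum>i\<le>n. J_scale J (coeff q i) ((f ^^ i) v))"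
  have w: "w \<in> W"
    unfolding w_def by (intro C.subspace_sum[OF W] C.subspace_scale[OF W] fv)
  \<comment> \<open>At i = 0 the polynomial X q has coefficient 0; the conditional records this
    because \<open>i - 1\<close> is again 0 there.\<close>
  have c: "coeff p i = (if i = 0 then 0 else coeff q (i - 1)) - z * coeff q i" for i
    unfolding p by (cases i) (simp_all add: algebra_simps)
  have "0 = (\<Sum>i\<le>Suc n. J_scale J (coeff p i) ((f ^^ i) v))"
    using Suc.prems Suc.hyps by simp
  also have "\<dots> = (\<Sum>i\<le>Suc n. J_scale J (if i = 0 then 0 else coeff q (i - 1)) ((f ^^ i) v))
      - (\<Sum>i\<le>Suc n. J_scale J z (J_scale J (coeff q i) ((f ^^ i) v)))"
    unfolding c by (simp add: C.scale_left_diff_distrib sum_subtractf del: sum.atMost_Suc)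
  also have "(\<Sum>i\<le>Suc n. J_scale J (if i = 0 then 0 else coeff q (i - 1)) ((f ^^ i) v)) = f w"
    unfolding w_def f_sum[OF finite_atMost] sum.atMost_Suc_shift by simp
  \<comment> \<open>The summand at \<open>Suc n\<close> vanishes, as q has degree n.\<close>
  also have "(\<Sum>i\<le>Suc n. J_scale J z (J_scale J (coeff q i) ((f ^^ i) v))) = J_scale J z w"
    using n by (simp add: w_def C.scale_sum_right coeff_eq_0)
  finally have "f w = J_scale J z w" by simp
  with w Suc.hyps(1)[of q] \<open>q \<noteq> 0\<close> n show ?case
    unfolding w_def by blast
qed

text \<open>The \<open>DIM('a) + 1\<close> iterates v, f v, f (f v), ... satisfy a nontrivial real
  linear relation, and its coefficients form a nonzero complex polynomial annihilating v.\<close>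

lemma eigenvector_exists:
  assumes W: "C.subspace W"
    and inv: "\<And>x. x \<in> W \<Longrightarrow> f x \<in> W"
    and add: "\<And>x y. x \<in> W \<Longrightarrow> y \<in> W \<Longrightarrow> f (x + y) = f x + f y"
    and scale: "\<And>c x. x \<in> W \<Longrightarrow> f (J_scale J c x) = J_scale J c (f x)"
    and v: "v \<in> W" "v \<noteq> 0"
  shows "\<exists>z. \<exists>x\<in>W. x \<noteq> 0 \<and> f x = J_scale J z x"
proof -
  define d where "d = DIM('a)"
  define F where "F = (\<lambda>i. (f ^^ i) v)"
  obtain c :: "nat \<Rightarrow> real" where c: "(\<Sum>i\<le>d. c i *\<^sub>R F i) = 0" "\<exists>i\<le>d. c i \<noteq> 0"
  \<comment> \<open>Dependence is a notion for sets and does not see repeated iterates; a repetition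
    F i = F j is itself a relation, with coefficients 1 and -1.\<close>
  proof (cases "inj_on F {..d}")
    case True
    then have "dependent (F ` {..d})"
      by (intro dependent_biggerset) (simp add: card_image d_def)
    then obtain u where "\<exists>x\<in>F ` {..d}. u x \<noteq> 0" "(\<Sum>x\<in>F ` {..d}. u x *\<^sub>R x) = 0"
      by (auto simp: dependent_finite)
    with True that[of "u \<circ> F"] show ?thesis
      by (auto simp: sum.reindex)
  next
    case False
    then obtain i j where ij: "i \<le> d" "j \<le> d" "i \<noteq> j" "F i = F j"
      by (auto simp: inj_on_def)
    have "(\<Sum>k\<le>d. ((if k = i then 1 else 0) - (if k = j then 1 else 0)) *\<^sub>R F k)
        = (\<Sum>k\<le>d. if k = i then F k else 0) - (\<Sum>k\<le>d. if k = j then F k else 0)"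
      unfolding sum_subtractf[symmetric] by (intro sum.cong) auto
    also have "\<dots> = 0" using ij by simp
    finally show ?thesis
      using ij by (intro that[of "\<lambda>k. (if k = i then 1 else 0) - (if k = j then 1 else 0)"]) auto
  qed
  define p where "p = (\<Sum>i\<le>d. monom (complex_of_real (c i)) i)"
  have p: "coeff p i = (if i \<le> d then of_real (c i) else 0)" for i
    by (simp add: p_def coeff_sum)
  have "p \<noteq> 0"
    using c(2) p by (metis coeff_0 of_real_eq_0_iff)
  have "degree p \<le> d"
    by (rule degree_le) (simp add: p)
  then have "(\<Sum>i\<le>degree p. J_scale J (coeff p i) (F i)) = (\<Sum>i\<le>d. J_scale J (coeff p i) (F i))"
    by (intro sum.mono_neutral_left) (auto simp: coeff_eq_0)
  also have "\<dots> = 0"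
    using c(1) by (simp add: p scaleR_eq_J_scale)
  finally show ?thesis
    using eigenvector_of_annihilating_poly[OF W inv add scale v \<open>p \<noteq> 0\<close>]
    unfolding F_def by blast
qed

text \<open>On a nonzero invariant subspace of least dimension every map is a scalar: its eigenspace
  there is nonzero and, by commutativity, invariant under the family, hence everything. The argument
  covers infinite index sets.\<close>

lemma joint_eigenvector_exists:
  assumes W: "C.subspace W" "W \<noteq> {0}"
    and inv: "\<And>i x. i \<in> I \<Longrightarrow> x \<in> W \<Longrightarrow> f i x \<in> W"
    and add: "\<And>i x y. i \<in> I \<Longrightarrow> x \<in> W \<Longrightarrow> y \<in> W \<Longrightarrow> f i (x + y) = f i x + f i y"
    and scale: "\<And>i c x. i \<in> I \<Longrightarrow> x \<in> W \<Longrightarrow> f i (J_scale J c x) = J_scale J c (f i x)"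
    and comm: "\<And>i j x. i \<in> I \<Longrightarrow> j \<in> I \<Longrightarrow> x \<in> W \<Longrightarrow> f i (f j x) = f j (f i x)"
  obtains v where "v \<in> W" "v \<noteq> 0" "\<And>i. i \<in> I \<Longrightarrow> \<exists>z. f i v = J_scale J z v"
proof -
  define P where "P = (\<lambda>U. C.subspace U \<and> U \<subseteq> W \<and> U \<noteq> {0} \<and> (\<forall>i\<in>I. f i ` U \<subseteq> U))"
  have "P W" using W inv by (auto simp: P_def)
  \<comment> \<open>Here \<open>dim\<close> is the real dimension: complex subspaces are real ones,
    and nested ones of equal real dimension coincide.\<close>
  then obtain U where U: "P U" and minimal: "\<And>E. P E \<Longrightarrow> dim U \<le> dim E"
    using ex_has_least_nat[of P W dim] by blast
  have sub: "C.subspace U" and UW: "U \<subseteq> W" and Uinv: "\<And>i x. i \<in> I \<Longrightarrow> x \<in> U \<Longrightarrow> f i x \<in> U"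
    using U by (auto simp: P_def)
  obtain u where u: "u \<in> U" "u \<noteq> 0"
    using U C.subspace_0[OF sub] by (auto simp: P_def)
  have "\<exists>z. f i u = J_scale J z u" if i: "i \<in> I" for i
  proof -
    have "\<exists>z. \<exists>x\<in>U. x \<noteq> 0 \<and> f i x = J_scale J z x"
      using UW i by (intro eigenvector_exists[OF sub _ _ _ u]) (auto intro: Uinv add scale)
    then obtain z x where x: "x \<in> U" "x \<noteq> 0" "f i x = J_scale J z x" by blast
    define E where "E = {x \<in> U. f i x = J_scale J z x}"
    have "C.subspace E"
      unfolding C.subspace_def
    proof (intro conjI allI ballI)
      show "0 \<in> E"
        using scale[OF i, of u 0] u UW by (auto simp: E_def C.subspace_0[OF sub])
      show "x + y \<in> E" if "x \<in> E" "y \<in> E" for x y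
        using that UW add[OF i, of x y]
        by (auto simp: E_def C.subspace_add[OF sub] C.scale_right_distrib)
      show "J_scale J c x \<in> E" if "x \<in> E" for c x
        using that UW scale[OF i, of x c]
        by (auto simp: E_def C.subspace_scale[OF sub] C.scale_left_commute)
    qed
    moreover have "f j y \<in> E" if "j \<in> I" "y \<in> E" for j y
    proof -
      have "y \<in> W" "y \<in> U" "f i y = J_scale J z y" using that UW by (auto simp: E_def)
      then show ?thesis
        using comm[OF i \<open>j \<in> I\<close>, of y] scale[OF \<open>j \<in> I\<close>, of y z] Uinv[OF \<open>j \<in> I\<close>]
        by (simp add: E_def)
    qed
    ultimately have "P E"
      using x UW by (auto simp: P_def E_def)
    then have "E = U"
      using minimal[of E]
      by (intro subspace_dim_equal C_subspace_imp_subspace sub \<open>C.subspace E\<close>) (auto simp: E_def)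
    then show ?thesis using u by (auto simp: E_def)
  qed
  with u UW that show thesis by blast
qed

section \<open>Orthonormal sets and orthogonal projection\<close>

definition orthonormal :: "'a set \<Rightarrow> bool" where
  "orthonormal B \<longleftrightarrow> (\<forall>b\<in>B. \<forall>c\<in>B. h b c = (if b = c then 1 else 0))"

lemma orthonormal_imp_independent:
  assumes "orthonormal B"
  shows "C.independent B"
  unfolding C.dependent_def
proof
  assume "\<exists>b\<in>B. b \<in> C.span (B - {b})"
  then obtain b where b: "b \<in> B" "b \<in> C.span (B - {b})" by blast
  have "C.span (B - {b}) \<subseteq> {x. h x b = 0}"
  proof (rule C.span_minimal)
    show "B - {b} \<subseteq> {x. h x b = 0}"
      using assms b by (auto simp: orthonormal_def)
    show "C.subspace {x. h x b = 0}"
      by (auto simp: C.subspace_def h_simps)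
  qed
  then have "h b b = 0" using b by blast
  then show False using assms b by (simp add: orthonormal_def)
qed

text \<open>The real span lies in the complex span, so complex independence gives real independence.
  The bound is what allows an orthonormal set of maximal size to be chosen.\<close>

lemma orthonormal_bound:
  assumes "orthonormal B"
  shows "finite B" "card B \<le> DIM('a)"
proof -
  have "span A \<subseteq> C.span A" for A
    by (intro span_minimal C.span_superset C_subspace_imp_subspace C.subspace_span)
  then have "independent B"
    using orthonormal_imp_independent[OF assms] unfolding dependent_def C.dependent_def by blast
  then show "finite B" "card B \<le> DIM('a)"
    using independent_bound by blast+
qed

text \<open>For orthonormal \<open>B\<close> this is the orthogonal projection onto the complement
  of the complex span of \<open>B\<close>.\<close>

definition perp :: "'a set \<Rightarrow> 'a \<Rightarrow> 'a" where
  "perp B x = x - (\<Sum>b\<in>B. J_scale J (h x b) b)"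

lemma perp_add: "perp B (x + y) = perp B x + perp B y"
  by (simp add: perp_def h_simps C.scale_left_distrib sum.distrib algebra_simps)

lemma perp_scale: "perp B (J_scale J c x) = J_scale J c (perp B x)"
  by (simp add: perp_def h_simps C.scale_right_diff_distrib C.scale_sum_right)

lemma h_sum_orthonormal:
  assumes "orthonormal B" "b \<in> B"
  shows "h (\<Sum>c\<in>B. J_scale J (f c) c) b = f b"
proof -
  have "h (\<Sum>c\<in>B. J_scale J (f c) c) b = (\<Sum>c\<in>B. if c = b then f b else 0)"
    using assms by (auto simp: h_sum_left h_simps orthonormal_def intro!: sum.cong)
  then show ?thesis using assms orthonormal_bound(1)[OF assms(1)] by simp
qed

lemma h_perp:
  assumes "orthonormal B" "b \<in> B"
  shows "h (perp B x) b = 0"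
  by (simp add: perp_def h_simps h_sum_orthonormal[OF assms])

lemma perp_combination:
  assumes "orthonormal B"
  shows "perp B (\<Sum>b\<in>B. J_scale J (f b) b) = 0"
  by (simp add: perp_def h_sum_orthonormal[OF assms])

lemma sum_in_span: "(\<Sum>b\<in>B. J_scale J (f b) b) \<in> C.span B"
  by (intro C.span_sum C.span_scale C.span_base)

section \<open>Unitary diagonalization of the commuting family\<close>

text \<open>An abstract form of the diagonalization: \<open>k\<close> stands for the family of maps,
  \<open>sq\<close> for the passage from X to \<open>\<omega> (J X) X\<close>, and
  \<open>form\<close> for the SKT identity.\<close>

lemma joint_eigenbasis_exists:
  fixes k :: "'i \<Rightarrow> 'a \<Rightarrow> 'a" and sq :: "'i \<Rightarrow> 'i"
  assumes V: "C.subspace V"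
    and inv: "\<And>i x. i \<in> I \<Longrightarrow> x \<in> V \<Longrightarrow> k i x \<in> V"
    and add: "\<And>i x y. i \<in> I \<Longrightarrow> x \<in> V \<Longrightarrow> y \<in> V \<Longrightarrow> k i (x + y) = k i x + k i y"
    and scale: "\<And>i c x. i \<in> I \<Longrightarrow> x \<in> V \<Longrightarrow> k i (J_scale J c x) = J_scale J c (k i x)"
    and comm: "\<And>i j x. i \<in> I \<Longrightarrow> j \<in> I \<Longrightarrow> x \<in> V \<Longrightarrow> k i (k j x) = k j (k i x)"
    and sq: "\<And>i. i \<in> I \<Longrightarrow> sq i \<in> I"
    and form: "\<And>i x y. i \<in> I \<Longrightarrow> x \<in> V \<Longrightarrow> y \<in> V \<Longrightarrow>
      h (k i (k i x)) y + h x (k i (k i y)) + 2 * h (k i x) (k i y)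
        = h (k (sq i) x) y + h x (k (sq i) y)"
  obtains B where "orthonormal B" "C.span B = V"
    "\<And>b i. b \<in> B \<Longrightarrow> i \<in> I \<Longrightarrow> \<exists>z. k i b = J_scale J z b"
proof -
  define P where "P = (\<lambda>B. orthonormal B \<and> B \<subseteq> V \<and> (\<forall>b\<in>B. \<forall>i\<in>I. \<exists>z. k i b = J_scale J z b))"
  have "P {}" by (simp add: P_def orthonormal_def)
  moreover have "\<forall>B. P B \<longrightarrow> card B < Suc DIM('a)"
    using orthonormal_bound by (simp add: P_def less_Suc_eq_le)
  ultimately have "\<exists>B. P B \<and> (\<forall>B'. P B' \<longrightarrow> card B' \<le> card B)"
    by (rule ex_has_greatest_nat)
  then obtain B where B: "P B" and maximal: "\<And>B'. P B' \<Longrightarrow> card B' \<le> card B"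
    by blast
  have on: "orthonormal B" and BV: "B \<subseteq> V" and fin: "finite B"
    using B orthonormal_bound by (auto simp: P_def)
  define \<beta> where "\<beta> = (\<lambda>i b. SOME z. k i b = J_scale J z b)"
  have \<beta>: "k i b = J_scale J (\<beta> i b) b" if "i \<in> I" "b \<in> B" for i b
    unfolding \<beta>_def by (rule someI_ex) (use B that in \<open>simp add: P_def\<close>)
  have combination: "(\<Sum>b\<in>B. J_scale J (f b) b) \<in> V" for f
    using sum_in_span C.span_minimal[OF BV V] by blast
  have "C.span B = V"
  proof (rule ccontr)
    assume "C.span B \<noteq> V"
    then obtain x where x: "x \<in> V" "x \<notin> C.span B"
      using C.span_minimal[OF BV V] by blast
    define W where "W = {w \<in> V. \<forall>b\<in>B. h w b = 0}"
    have W: "C.subspace W"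
      using V by (auto simp: W_def C.subspace_def h_simps)
    have WV: "w \<in> V" if "w \<in> W" for w using that by (simp add: W_def)
    have perp_W: "perp B y \<in> W" if "y \<in> V" for y
      using that h_perp[OF on] C.subspace_diff[OF V that combination] by (auto simp: W_def perp_def)
    have "perp B x \<noteq> 0"
      using x sum_in_span[of "h x" B] by (auto simp: perp_def)
    with perp_W[OF x(1)] have "W \<noteq> {0}" by blast
    have k0: "k i 0 = 0" if "i \<in> I" for i
      using scale[OF that x(1), of 0] by simp
    have k_comb: "k i (\<Sum>b\<in>B. J_scale J (f b) b) = (\<Sum>b\<in>B. J_scale J (f b * \<beta> i b) b)"
      if i: "i \<in> I" for i f
    proof -
      have "k i (\<Sum>b\<in>A. J_scale J (f b) b) = (\<Sum>b\<in>A. J_scale J (f b * \<beta> i b) b)"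
        if "finite A" "A \<subseteq> B" for A
        using that
      proof (induction A)
        case empty then show ?case using k0[OF i] by simp
      next
        case (insert b A)
        have "(\<Sum>b\<in>A. J_scale J (f b) b) \<in> V"
          using insert BV by (intro C.subspace_sum[OF V] C.subspace_scale[OF V]) auto
        with insert BV show ?case
          by (auto simp: add[OF i] scale[OF i] C.subspace_scale[OF V] \<beta>[OF i])
      qed
      from this[OF fin subset_refl] show ?thesis .
    qed
    \<comment> \<open>Since \<open>k i\<close> preserves the span of \<open>B\<close>, its
      compression acts like the induced map on the quotient of V by that span. Hence the
      compressions commute, although \<open>k i\<close> may fail to preserve W.\<close>
    have k_perp: "perp B (k i (perp B y)) = perp B (k i y)" if "i \<in> I" "y \<in> V" for i y
    proof -
      have "y = perp B y + (\<Sum>b\<in>B. J_scale J (h y b) b)" by (simp add: perp_def)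
      then have "k i y = k i (perp B y) + (\<Sum>b\<in>B. J_scale J (h y b * \<beta> i b) b)"
        using add[OF that(1) WV[OF perp_W[OF that(2)]] combination] k_comb[OF that(1)] by metis
      then show ?thesis by (simp add: perp_add perp_combination[OF on])
    qed
    obtain v0 where v0: "v0 \<in> W" "v0 \<noteq> 0"
      and v0_eig: "\<And>i. i \<in> I \<Longrightarrow> \<exists>z. perp B (k i v0) = J_scale J z v0"
    proof (rule joint_eigenvector_exists[OF W \<open>W \<noteq> {0}\<close>, of I "\<lambda>i y. perp B (k i y)"])
      show "perp B (k i (perp B (k j y))) = perp B (k j (perp B (k i y)))"
        if "i \<in> I" "j \<in> I" "y \<in> W" for i j y
        using that by (simp add: k_perp inv WV comm[of i j])
    qed (auto simp: WV inv perp_W add scale perp_add perp_scale)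
    define v where "v = (1 / sqrt (g v0 v0)) *\<^sub>R v0"
    have v: "v \<in> W"
      unfolding v_def scaleR_eq_J_scale by (intro C.subspace_scale[OF W] v0)
    have hvv: "h v v = 1"
      using g_pos[OF v0(2)] by (simp add: v_def h_self g_simps real_sqrt_mult_self[of "g v0 v0"])
    have hvb: "h v b = 0" "h b v = 0" if "b \<in> B" for b
      using v that h_commute[of v b] by (auto simp: W_def)
    have "\<exists>z. perp B (k i v) = J_scale J z v" if i: "i \<in> I" for i
    proof -
      obtain z where "perp B (k i v0) = J_scale J z v0" using v0_eig[OF i] by blast
      then have "perp B (k i v) = J_scale J z v"
        by (simp add: v_def scaleR_eq_J_scale scale[OF i WV[OF v0(1)]] perp_scale mult.commute)
      then show ?thesis by blast
    qed
    then obtain \<alpha> where \<alpha>: "perp B (k i v) = J_scale J (\<alpha> i) v" if "i \<in> I" for i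
      by metis
    define u where "u = (\<lambda>i b. h (k i v) b)"
    have kv: "k i v = J_scale J (\<alpha> i) v + (\<Sum>b\<in>B. J_scale J (u i b) b)" if "i \<in> I" for i
      using \<alpha>[OF that] by (simp add: perp_def u_def algebra_simps)
    have h_comb_v: "h (\<Sum>b\<in>B. J_scale J (f b) b) v = 0" for f
      by (simp add: h_sum_left h_simps hvb)
    have kkv: "k j (k i v) = J_scale J (\<alpha> i) (k j v) + (\<Sum>b\<in>B. J_scale J (u i b * \<beta> j b) b)"
      if "i \<in> I" "j \<in> I" for i j
      unfolding kv[OF that(1)]
      by (simp add: add[OF that(2)] scale[OF that(2)] WV[OF v] C.subspace_scale[OF V] combination
          k_comb[OF that(2)])
    have h_kv_v: "h (k i v) v = \<alpha> i" if "i \<in> I" for i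
      by (simp add: kv[OF that] h_simps hvv h_comb_v)
    have h_kkv_v: "h (k j (k i v)) v = \<alpha> i * \<alpha> j" if "i \<in> I" "j \<in> I" for i j
      by (simp add: kkv[OF that] h_simps h_comb_v h_kv_v[OF that(2)])
    have h_kkv_b: "h (k j (k i v)) b = \<alpha> i * u j b + u i b * \<beta> j b"
      if "i \<in> I" "j \<in> I" "b \<in> B" for i j b
      by (simp add: kkv[OF that(1,2)] h_simps h_sum_orthonormal[OF on that(3)] u_def)
    have "k i v = J_scale J (\<alpha> i) v" if i: "i \<in> I" for i
    proof (rule ccontr)
      assume neq: "k i v \<noteq> J_scale J (\<alpha> i) v"
      define s where "s = sq i"
      have s: "s \<in> I" using sq[OF i] by (simp add: s_def)
      define R where "R = (\<Sum>b\<in>B. J_scale J (u i b) b)"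
      have R: "k i v = J_scale J (\<alpha> i) v + R" using kv[OF i] by (simp add: R_def)
      have Rv: "h R v = 0" "h v R = 0"
        using h_comb_v h_commute[of R v] by (auto simp: R_def)
      have "R \<noteq> 0" using neq R by auto
      have hkk: "h (k i v) (k i v) = \<alpha> i * cnj (\<alpha> i) + of_real (g R R)"
        by (simp add: R h_simps Rv hvv h_self[of R])
      \<comment> \<open>The squared norm of all of R serves as the positive number r for every b, so
        each coefficient of R vanishes.\<close>
      have "u i b = 0" if b: "b \<in> B" for b
      proof (rule off_diagonal_entry_zero)
        have bV: "b \<in> V" using b BV by blast
        have hbb: "h b b = 1" using on b by (simp add: orthonormal_def)
        have "h (k i (k s v)) b = h (k s (k i v)) b"
          using comm[OF i s WV[OF v]] by simp
        then show "(\<alpha> s - \<beta> s b) * u i b = (\<alpha> i - \<beta> i b) * u s b"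
          by (simp add: h_kkv_b i s b algebra_simps)
        show "(\<alpha> i)\<^sup>2 + cnj ((\<alpha> i)\<^sup>2) + 2 * (\<alpha> i * cnj (\<alpha> i) + of_real (g R R)) = \<alpha> s + cnj (\<alpha> s)"
          using form[OF i WV[OF v] WV[OF v]] h_commute[of v "k i (k i v)"] h_commute[of v "k s v"]
          by (simp add: hkk h_kkv_v i h_kv_v s flip: s_def) (simp add: power2_eq_square)
        \<comment> \<open>The terms \<open>h v (k i (k i b))\<close> and \<open>h v (k s b)\<close>
          drop out, because these images are multiples of b and b is orthogonal to v.\<close>
        show "\<alpha> i * u i b + u i b * \<beta> i b + 2 * (cnj (\<beta> i b) * u i b) = u s b"
          using form[OF i WV[OF v] bV]
          by (simp add: h_kkv_b i b \<beta> s scale[OF i bV] h_simps hvb flip: s_def)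
             (simp add: u_def algebra_simps)
        show "(\<beta> i b)\<^sup>2 + cnj ((\<beta> i b)\<^sup>2) + 2 * (\<beta> i b * cnj (\<beta> i b)) = \<beta> s b + cnj (\<beta> s b)"
          using form[OF i bV bV]
          by (simp add: i b \<beta> s scale[OF i bV] h_simps hbb power2_eq_square mult.commute flip: s_def)
        show "g R R > 0" using g_pos \<open>R \<noteq> 0\<close> .
      qed
      then have "R = 0" by (simp add: R_def)
      with \<open>R \<noteq> 0\<close> show False ..
    qed
    moreover have "orthonormal (insert v B)"
      using on hvv hvb by (auto simp: orthonormal_def)
    ultimately have "P (insert v B)"
      using B WV[OF v] by (auto simp: P_def)
    moreover have "v \<notin> B" using hvb hvv by auto
    ultimately show False
      using maximal[of "insert v B"] fin by simp
  qed
  with on B that show thesis by (auto simp: P_def)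
qed

end

section \<open>The Chevalley-Eilenberg differential of two- and three-forms\<close>

lemma ce_diff_3:
  "ce_diff br \<beta> [x, y, z] = - \<beta> [br x y, z] + \<beta> [br x z, y] - \<beta> [br y z, x]"
  by (simp add: ce_diff_def eval_nat_numeral nths_Cons)

lemma ce_diff_4:
  "ce_diff br \<beta> [x, y, z, w] = - \<beta> [br x y, z, w] + \<beta> [br x z, y, w] - \<beta> [br x w, y, z]
    - \<beta> [br y z, x, w] + \<beta> [br y w, x, z] - \<beta> [br z w, x, y]"
  by (simp add: ce_diff_def eval_nat_numeral nths_Cons)

section \<open>The commuting complex linear maps of an SKT shear\<close>

locale skt_shear = hermitian_space g J
  for g :: "'a::euclidean_space \<Rightarrow> 'a \<Rightarrow> real" and J :: "'a \<Rightarrow> 'a" +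
  fixes \<aa> :: "'a set" and \<omega> :: "'a \<Rightarrow> 'a \<Rightarrow> 'a"
  assumes shear: "two_step_shear_data \<aa> \<omega>" and skt: "SKT \<omega> g J"
begin

lemma subspace_\<aa>: "subspace \<aa>"
  and bilinear_\<omega>: "bilinear \<omega>"
  and \<omega>_self: "\<omega> x x = 0"
  and \<omega>_in: "\<omega> x y \<in> \<aa>"
  and \<omega>_\<aa>: "x \<in> \<aa> \<Longrightarrow> y \<in> \<aa> \<Longrightarrow> \<omega> x y = 0"
  and jacobi: "\<omega> (\<omega> x y) z + \<omega> (\<omega> y z) x + \<omega> (\<omega> z x) y = 0"
  and integrable: "\<omega> (J x) (J y) - J (\<omega> (J x) y) - J (\<omega> x (J y)) - \<omega> x y = 0"
  using shear skt unfolding two_step_shear_data_def SKT_def integrable_on_lie_def by blast+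

lemmas \<omega>_simps = bilinear_ladd[OF bilinear_\<omega>] bilinear_radd[OF bilinear_\<omega>]
  bilinear_lmul[OF bilinear_\<omega>] bilinear_rmul[OF bilinear_\<omega>]
  bilinear_lneg[OF bilinear_\<omega>] bilinear_rneg[OF bilinear_\<omega>]

lemma \<omega>_anticommute: "\<omega> y x = - \<omega> x y"
proof -
  have "\<omega> x x + \<omega> x y + (\<omega> y x + \<omega> y y) = 0"
    using \<omega>_self[of "x + y"] unfolding \<omega>_simps by (simp add: algebra_simps)
  then show ?thesis by (simp add: \<omega>_self eq_neg_iff_add_eq_0 add.commute)
qed

lemma mem_a_J_iff: "x \<in> a_J J \<aa> \<longleftrightarrow> x \<in> \<aa> \<and> J x \<in> \<aa>"
proof -
  have "x = J (- J x)" by (simp add: J_simps)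
  then show ?thesis
    using subspace_neg[OF subspace_\<aa>] by (auto simp: a_J_def)
qed

lemma subspace_a_J: "C.subspace (a_J J \<aa>)"
  using subspace_\<aa>
  by (auto simp: C.subspace_def mem_a_J_iff J_scale_def J_simps subspace_0 subspace_add
      subspace_scale subspace_neg subspace_diff)

text \<open>In the integrability equation \<open>\<omega> x (J y)\<close> and
  \<open>\<omega> x y\<close> vanish, since x, y and J y all lie in \<open>\<aa>\<close>.\<close>

lemma \<omega>_J_linear:
  assumes "x \<in> \<aa>" "y \<in> a_J J \<aa>"
  shows "\<omega> (J x) (J y) = J (\<omega> (J x) y)"
  using integrable[of x y] assms by (simp add: mem_a_J_iff \<omega>_\<aa> J_simps)

text \<open>Using all of \<open>\<aa>\<close> as parameter space, rather than \<open>\<aa>\<^sub>r\<close>, avoids projecting \<open>\<omega>(J X, X)\<close> to \<open>\<aa>\<^sub>r\<close>: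
  for \<open>x \<in> \<aa>\<^sub>J\<close> the map \<open>A x\<close> vanishes on \<open>\<aa>\<close>.\<close>

definition A :: "'a \<Rightarrow> 'a \<Rightarrow> 'a" where
  "A x y = - \<omega> (J x) y"

text \<open>By complex linearity J maps \<open>A x y\<close> to
  \<open>- \<omega> (J x) (J y)\<close>, which is again a value of the \<open>\<aa>\<close>-valued
  form.\<close>

lemma A_in: "x \<in> \<aa> \<Longrightarrow> y \<in> a_J J \<aa> \<Longrightarrow> A x y \<in> a_J J \<aa>"
  using \<omega>_J_linear[of x y, symmetric] \<omega>_in subspace_neg[OF subspace_\<aa>]
  by (simp add: mem_a_J_iff A_def J_simps)

lemma A_add: "A x (y + z) = A x y + A x z"
  by (simp add: A_def \<omega>_simps)

lemma A_add_left: "A (x + y) z = A x z + A y z"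
  by (simp add: A_def \<omega>_simps J_simps)

lemma A_scaleR_left: "A (r *\<^sub>R x) z = r *\<^sub>R A x z"
  by (simp add: A_def \<omega>_simps J_simps)

lemma A_J: "x \<in> \<aa> \<Longrightarrow> y \<in> a_J J \<aa> \<Longrightarrow> A x (J y) = J (A x y)"
  by (simp add: A_def \<omega>_J_linear J_simps)

lemma A_scale: "x \<in> \<aa> \<Longrightarrow> y \<in> a_J J \<aa> \<Longrightarrow> A x (J_scale J c y) = J_scale J c (A x y)"
  using A_J[of x y] by (simp add: J_scale_def A_add) (simp add: A_def \<omega>_simps J_simps)

text \<open>This is the Jacobi identity on (J x, J y, z): the term
  \<open>\<omega> (\<omega> (J x) (J y)) z\<close> has both arguments in \<open>\<aa>\<close> and
  vanishes.\<close>

lemma A_commute: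
  assumes "z \<in> a_J J \<aa>"
  shows "A x (A y z) = A y (A x z)"
proof -
  have "\<omega> (\<omega> (J x) (J y)) z = 0"
    using assms by (intro \<omega>_\<aa> \<omega>_in) (simp add: mem_a_J_iff)
  then have "\<omega> (\<omega> (J y) z) (J x) + \<omega> (\<omega> z (J x)) (J y) = 0"
    using jacobi[of "J x" "J y" z] by simp
  moreover have "\<omega> (\<omega> (J y) z) (J x) = - \<omega> (J x) (\<omega> (J y) z)"
    by (rule \<omega>_anticommute)
  moreover have "\<omega> (\<omega> z (J x)) (J y) = \<omega> (J y) (\<omega> (J x) z)"
    by (subst \<omega>_anticommute, subst \<omega>_anticommute[of z]) (simp add: \<omega>_simps)
  ultimately show ?thesis
    by (simp add: A_def \<omega>_simps)
qed

section \<open>The SKT equation as a Hermitian identity\<close>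

text \<open>The outer J cancels, as \<sigma>(U, J z) = g(J U, J z) = g(U, z). Up to sign this
  three-form is the torsion of the Bismut connection.\<close>

lemma J_pullback_torsion:
  "J_pullback J (ce_diff \<omega> (kaehler_form g J)) [x, y, z]
    = - g (\<omega> (J x) (J y)) z + g (\<omega> (J x) (J z)) y - g (\<omega> (J y) (J z)) x"
  by (simp add: J_pullback_def ce_diff_3 kaehler_form_def)

text \<open>On (J x, x, y, J z) only the three brackets with J x survive in the differential, the
  other pairs lying in \<open>\<aa>\<close>. The surviving brackets are
  \<open>\<omega> (J x) x\<close>, \<open>- A x y\<close> and \<open>- J (A x z)\<close>.\<close>

lemma g_A_identity:
  assumes x: "x \<in> \<aa>" and y: "y \<in> a_J J \<aa>" and z: "z \<in> a_J J \<aa>"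
  shows "g (A x (A x y)) z + g y (A x (A x z)) + 2 * g (A x y) (A x z)
    = g (A (\<omega> (J x) x) y) z + g y (A (\<omega> (J x) x) z)"
proof -
  define w where "w = \<omega> (J x) x"
  have w: "w \<in> \<aa>" by (simp add: w_def \<omega>_in)
  define H where "H = J_pullback J (ce_diff \<omega> (kaehler_form g J))"
  have H: "H [p, q, r] = - g (\<omega> (J p) (J q)) r + g (\<omega> (J p) (J r)) q - g (\<omega> (J q) (J r)) p"
    for p q r
    unfolding H_def by (rule J_pullback_torsion)
  have \<omega>_JJ: "\<omega> (J p) (J q) = - J (A p q)" if "p \<in> \<aa>" "q \<in> a_J J \<aa>" for p q
    using \<omega>_J_linear[OF that] by (simp add: A_def J_simps)
  have \<omega>_JJ': "\<omega> (J q) (J p) = J (A p q)" if "p \<in> \<aa>" "q \<in> a_J J \<aa>" for p q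
    using \<omega>_JJ[OF that] \<omega>_anticommute[of "J q" "J p"] by simp
  have mem: "p \<in> \<aa>" "J p \<in> a_J J \<aa>" if "p \<in> a_J J \<aa>" for p
    using that subspace_neg[OF subspace_\<aa>] by (auto simp: mem_a_J_iff)
  have \<omega>0: "\<omega> x y = 0" "\<omega> x (J z) = 0" "\<omega> y (J z) = 0"
    using x y z by (auto intro!: \<omega>_\<aa> mem)
  have \<omega>J0: "\<omega> (J p) (- q) = 0" if "p \<in> a_J J \<aa>" "q \<in> a_J J \<aa>" for p q
    using that by (intro \<omega>_\<aa> mem subspace_neg[OF subspace_\<aa>])
  have \<omega>A: "\<omega> (J p) (- q) = A p q" for p q
    by (simp add: A_def \<omega>_simps)
  have H1: "H [w, y, J z] = g (A w y) z + g y (A w z)"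
    using \<omega>J0[of y z] w y z
    by (simp add: H \<omega>_JJ \<omega>A[of w] mem g_simps g_commute)
  have H2: "H [p, x, J q] = - g (A x p) q - g (A x q) p"
    if "p \<in> a_J J \<aa>" "q \<in> a_J J \<aa>" for p q
    using \<omega>J0[of p q] x that
    by (simp add: H \<omega>_JJ' \<omega>A[of x] mem g_simps)
  have Ay: "\<omega> (J x) y = - A x y" and Az: "\<omega> (J x) (J z) = - J (A x z)"
    using \<omega>_JJ[OF x z] by (simp_all add: A_def)
  have neg: "- p \<in> a_J J \<aa>" if "p \<in> a_J J \<aa>" for p
    using C.subspace_neg[OF subspace_a_J that] .
  have A_neg: "A x (- p) = - A x p" for p
    by (simp add: A_def \<omega>_simps)
  \<comment> \<open>Writing y as \<open>J (- J y)\<close> makes \<open>H2\<close> applicable, with q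
    = - J y.\<close>
  have "H [- J (A x z), x, J (- J y)] = - g (A x (A x z)) y - g (A x y) (A x z)"
    using x y z by (subst H2) (simp_all add: neg mem A_in A_neg A_J g_simps)
  then have "H [- J (A x z), x, y] = - g (A x (A x z)) y - g (A x y) (A x z)"
    by (simp add: J_simps)
  moreover have "H [- A x y, x, J z] = g (A x (A x y)) z + g (A x z) (A x y)"
    using x y z by (subst H2) (simp_all add: neg A_in A_neg g_simps)
  moreover have "H [0, p, q] = 0" for p q
    by (simp add: H J_simps g_simps bilinear_lzero[OF bilinear_\<omega>])
  moreover have "ce_diff \<omega> H [J x, x, y, J z] = 0"
    using skt by (simp add: SKT_def H_def)
  ultimately show ?thesis
    using H1 by (simp add: ce_diff_4 \<omega>0 Ay Az g_simps g_commute flip: w_def)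
qed

text \<open>The real part is the identity for g at z, the imaginary part the one at J z, because the
  maps commute with J.\<close>

lemma h_A_identity:
  assumes x: "x \<in> \<aa>" and y: "y \<in> a_J J \<aa>" and z: "z \<in> a_J J \<aa>"
  shows "h (A x (A x y)) z + h y (A x (A x z)) + 2 * h (A x y) (A x z)
    = h (A (\<omega> (J x) x) y) z + h y (A (\<omega> (J x) x) z)"
proof -
  have "J z \<in> a_J J \<aa>"
    using z subspace_neg[OF subspace_\<aa>] by (auto simp: mem_a_J_iff)
  then show ?thesis
    using g_A_identity[OF x y z] g_A_identity[OF x y, of "J z"] x z
    by (simp add: complex_eq_iff herm_def A_J A_in \<omega>_in)
qed

section \<open>The component K and the unitary eigenbasis\<close>

lemma a_J_part_eq:
  assumes "v \<in> a_J J \<aa>"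
  shows "a_J_part g J \<aa> v = v"
  unfolding a_J_part_def
proof (rule the_equality)
  show "v \<in> a_J J \<aa> \<and> v - v \<in> a_r g J \<aa>"
    using assms by (simp add: a_r_def subspace_0[OF subspace_\<aa>] g_simps)
next
  fix u assume u: "u \<in> a_J J \<aa> \<and> v - u \<in> a_r g J \<aa>"
  then have "v - u \<in> a_J J \<aa>"
    using assms C.subspace_diff[OF subspace_a_J] by blast
  with u have "g (v - u) (v - u) = 0" by (simp add: a_r_def)
  then show "u = v" using g_pos[of "v - u"] by force
qed

text \<open>The image already lies in \<open>a_J J \<aa>\<close>, so taking the component there
  changes nothing.\<close>

lemma K_eq_A: "x \<in> \<aa> \<Longrightarrow> y \<in> a_J J \<aa> \<Longrightarrow> K g J \<aa> \<omega> x y = A x y"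
  using A_in[of x y] by (simp add: K_def A_def a_J_part_eq)

lemma unitary_eigenbasis_exists:
  "\<exists>m Y \<alpha>. m = vector_space.dim (J_scale J) (a_J J \<aa>) \<and>
     unitary_basis g J m Y (a_J J \<aa>) \<and>
     (\<forall>i\<in>{1..m}. complex_form_on (a_r g J \<aa>) (\<alpha> i)) \<and>
     (\<forall>X\<in>a_r g J \<aa>. \<forall>i\<in>{1..m}. K g J \<aa> \<omega> X (Y i) = J_scale J (\<alpha> i X) (Y i))"
proof -
  obtain B where B: "orthonormal B" "C.span B = a_J J \<aa>"
    and eig: "\<And>b x. b \<in> B \<Longrightarrow> x \<in> \<aa> \<Longrightarrow> \<exists>z. A x b = J_scale J z b"
    by (rule joint_eigenbasis_exists[OF subspace_a_J, of \<aa> A "\<lambda>x. \<omega> (J x) x"])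
       (auto simp: A_in A_add A_scale \<omega>_in h_A_identity intro: A_commute)
  obtain Y where Y: "bij_betw Y {1..card B} B"
    using ex_bij_betw_nat_finite_1 orthonormal_bound(1)[OF B(1)] by blast
  then have Y_inj: "inj_on Y {1..card B}" and Y_image: "Y ` {1..card B} = B"
    by (auto simp: bij_betw_def)
  \<comment> \<open>Pairing with the unit vector \<open>Y i\<close> reads off the eigenvalue, and in
    this form it is visibly real linear in x.\<close>
  define \<alpha> where "\<alpha> = (\<lambda>i x. h (A x (Y i)) (Y i))"
  have "card B = C.dim (a_J J \<aa>)"
    using C.dim_eq_card[of B "a_J J \<aa>"] B orthonormal_imp_independent
      C.span_eq_iff[THEN iffD2, OF subspace_a_J] by simp
  moreover have "unitary_basis g J (card B) Y (a_J J \<aa>)"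
    unfolding unitary_basis_def
  proof (intro conjI ballI)
    fix i j assume ij: "i \<in> {1..card B}" "j \<in> {1..card B}"
    then have "Y i \<in> B" "Y j \<in> B" using Y_image by blast+
    then show "h (Y i) (Y j) = (if i = j then 1 else 0)"
      using B(1) inj_on_eq_iff[OF Y_inj ij] by (simp add: orthonormal_def)
  qed (use B Y_inj Y_image orthonormal_imp_independent in simp_all)
  moreover have "complex_form_on (a_r g J \<aa>) (\<alpha> i)" for i
    by (simp add: complex_form_on_def \<alpha>_def A_add_left A_scaleR_left h_simps h_scaleR_left
        scaleR_conv_of_real)
  moreover have "K g J \<aa> \<omega> x (Y i) = J_scale J (\<alpha> i x) (Y i)"
    if "x \<in> a_r g J \<aa>" "i \<in> {1..card B}" for x i
  proof -
    have x: "x \<in> \<aa>" using that by (simp add: a_r_def)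
    have b: "Y i \<in> B" using that Y_image by blast
    then have "Y i \<in> a_J J \<aa>" using B(2) C.span_base by blast
    moreover obtain z where "A x (Y i) = J_scale J z (Y i)" using eig b x by blast
    moreover have "h (Y i) (Y i) = 1" using B(1) b by (simp add: orthonormal_def)
    ultimately show ?thesis by (simp add: K_eq_A x \<alpha>_def h_simps)
  qed
  ultimately show ?thesis by blast
qed

end

theorem proposition3p8:
  fixes n :: nat
    and g :: "real ^ 'd \<Rightarrow> real ^ 'd \<Rightarrow> real"
    and J :: "real ^ 'd \<Rightarrow> real ^ 'd"
    and \<aa> :: "(real ^ 'd) set"
    and \<omega> :: "real ^ 'd \<Rightarrow> real ^ 'd \<Rightarrow> real ^ 'd"
  assumes "CARD('d) = 2 * n"
    and "flat_kaehler g J"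
    and "two_step_shear_data \<aa> \<omega>"
    and "SKT \<omega> g J"
  shows "\<exists>(m::nat) (Y :: nat \<Rightarrow> real ^ 'd) (\<alpha> :: nat \<Rightarrow> real ^ 'd \<Rightarrow> complex).
           m = vector_space.dim (J_scale J) (a_J J \<aa>) \<and>
           unitary_basis g J m Y (a_J J \<aa>) \<and>
           (\<forall>i\<in>{1..m}. complex_form_on (a_r g J \<aa>) (\<alpha> i)) \<and>
           (\<forall>X\<in>a_r g J \<aa>. \<forall>i\<in>{1..m}. K g J \<aa> \<omega> X (Y i) = J_scale J (\<alpha> i X) (Y i))"
proof -
  interpret skt_shear g J \<aa> \<omega>
    using assms by unfold_locales
  show ?thesis by (rule unitary_eigenbasis_exists)
qed

end
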